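(* Assume that for every $\hat\lambda\in\mathbb{R}^{n_\lambda}$ with $\hat\lambda\ge 0$, the completion linear program $$\max_{\mu\ge 0}\ \{ g^\top\mu:\ G^\top\mu\le q-B^\top\hat\lambda\}$$ is feasible and bounded. Then for any vector $\tilde\lambda\in\mathbb{R}^{n_\lambda}$ (a predicted output), with $\hat\lambda:=(\tilde\lambda)_+$, there exists an optimal solution $\hat\mu(\hat\lambda)$ of the completion linear program such that $(\hat\lambda,\hat\mu(\hat\lambda))$ is dual-feasible, i.e. $$B^\top\hat\lambda+G^\top\hat\mu(\hat\lambda)\le q,\qquad \hat\lambda\ge 0,\qquad \hat\mu(\hat\lambda)\ge 0.$$ Consequently the cut $\theta\ge d(y)^\top\hat\lambda+g^\top\hat\mu(\hat\lambda)$ is valid for all $y$, i.e. $Q(y)\ge d(y)^\top\hat\lambda+g^\top\hat\mu(\hat\lambda)$ for all $y$.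
   Context: Data: real matrices $A,B,G$ and real vectors $b,g,q$ of compatible dimensions, where $B$ has $n_\lambda$ rows; $Y$ is a set of integer vectors (first-stage decisions). For a first-stage vector $y$ put $d(y):=b-Ay$. The recourse value is $$Q(y):=\min_{x\ge 0}\{q^\top x:\ Bx\ge d(y),\ Gx\ge g\},$$ with the convention $Q(y)=+\infty$ if the linear program is infeasible. Its dual is $\max\{d(y)^\top\lambda+g^\top\mu:\ B^\top\lambda+G^\top\mu\le q,\ \lambda\ge 0,\ \mu\ge 0\}$. Standing assumption: the recourse linear program is feasible and bounded for every $y\in Y$. For a vector $v$, $(v)_+$ denotes the componentwise positive part $\max\{v_i,0\}$. A cut $\theta\ge \ell(y)$ is valid if $Q(y)\ge\ell(y)$. All vector inequalities are componentwise. *)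

theory Defs
  imports "HOL-Analysis.Analysis"
begin

text \<open>
  The order on \<open>real ^ 'n\<close> is the componentwise one. Index types:
  \<open>'y\<close> for first-stage variables, \<open>'x\<close> for recourse variables, \<open>'l\<close> for the rows of
  \<open>A\<close>, \<open>B\<close> and \<open>b\<close> (so \<open>CARD('l)\<close> is the dimension of the dual vector \<open>lam\<close>), and
  \<open>'m\<close> for the rows of \<open>G\<close> and \<open>g\<close>.
\<close>

definition rhs :: "real ^ 'y ^ 'l \<Rightarrow> real ^ 'l \<Rightarrow> real ^ 'y \<Rightarrow> real ^ 'l" where
  "rhs A b y = b - A *v y"

definition recourse_feasible ::
  "real ^ 'x ^ 'l \<Rightarrow> real ^ 'x ^ 'm \<Rightarrow> real ^ 'm \<Rightarrow> real ^ 'l \<Rightarrow> (real ^ 'x) set" where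
  "recourse_feasible B G g d = {x. 0 \<le> x \<and> d \<le> B *v x \<and> g \<le> G *v x}"

text \<open>
  The infimum is taken in the extended reals: it is \<open>\<infinity>\<close> when the linear program is infeasible
  and \<open>-\<infinity>\<close> when it is unbounded; otherwise a linear program attains it, so it is the minimum.
\<close>

definition recourse_value ::
  "real ^ 'y ^ 'l \<Rightarrow> real ^ 'x ^ 'l \<Rightarrow> real ^ 'x ^ 'm \<Rightarrow> real ^ 'l \<Rightarrow> real ^ 'm \<Rightarrow> real ^ 'x
    \<Rightarrow> real ^ 'y \<Rightarrow> ereal" where
  "recourse_value A B G b g q y =
     (INF x \<in> recourse_feasible B G g (rhs A b y). ereal (q \<bullet> x))"

definition dual_feasible ::
  "real ^ 'x ^ 'l \<Rightarrow> real ^ 'x ^ 'm \<Rightarrow> real ^ 'x \<Rightarrow> real ^ 'l \<Rightarrow> real ^ 'm \<Rightarrow> bool" where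
  "dual_feasible B G q lam \<mu> \<longleftrightarrow>
     transpose B *v lam + transpose G *v \<mu> \<le> q \<and> 0 \<le> lam \<and> 0 \<le> \<mu>"

definition completion_feasible ::
  "real ^ 'x ^ 'l \<Rightarrow> real ^ 'x ^ 'm \<Rightarrow> real ^ 'x \<Rightarrow> real ^ 'l \<Rightarrow> (real ^ 'm) set" where
  "completion_feasible B G q lam = {\<mu>. 0 \<le> \<mu> \<and> transpose G *v \<mu> \<le> q - transpose B *v lam}"

definition completion_optimal ::
  "real ^ 'x ^ 'l \<Rightarrow> real ^ 'x ^ 'm \<Rightarrow> real ^ 'm \<Rightarrow> real ^ 'x \<Rightarrow> real ^ 'l \<Rightarrow> real ^ 'm \<Rightarrow> bool" where
  "completion_optimal B G g q lam \<mu> \<longleftrightarrow>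
     \<mu> \<in> completion_feasible B G q lam \<and>
     (\<forall>\<mu>' \<in> completion_feasible B G q lam. g \<bullet> \<mu>' \<le> g \<bullet> \<mu>)"

definition pos_part :: "real ^ 'n \<Rightarrow> real ^ 'n" where
  "pos_part v = (\<chi> i. max (v $ i) 0)"

definition valid_cut_at :: "('a \<Rightarrow> ereal) \<Rightarrow> ('a \<Rightarrow> real) \<Rightarrow> 'a \<Rightarrow> bool" where
  "valid_cut_at Q l y \<longleftrightarrow> Q y \<ge> ereal (l y)"

end

theory Submission
  imports Defs
begin

text \<open>
  The positive part of any prediction is nonnegative, so the hypothesis on the completion program
  applies to it. The constraints of the completion program, together with
  \<open>lam \<ge> 0\<close>, are those of the dual of the recourse program; hence an optimal completion is
  dual feasible, and the cut is weak duality
  (\<open>linear_program_weak_duality\<close>). Weak duality compares the cut with each feasible recourse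
  decision separately, so it bounds the infimum for every \<open>y\<close>, including those for which the
  recourse program is infeasible.

  The one substantial point is that a feasible and bounded linear program attains its
  maximum (\<open>linear_program_attains_max\<close>). After adding slack variables, the pairs
  (right-hand side, objective value) that can be realised form the image of a nonnegative orthant
  under a linear map. Such an image is a finitely generated cone and therefore closed. Its slice at
  the given right-hand side is the set of attainable objective values, which is thus a closed
  set of reals and contains its supremum.
\<close>

text \<open>This description lets the closedness of finitely generated cones apply to linear images of the
  orthant.\<close>

lemma nonneg_orthant_eq_convex_cone_hull:
  "{x :: 'a :: ordered_euclidean_space. 0 \<le> x} = convex_cone hull Basis"
proof (rule hull_unique [symmetric])
  show "Basis \<subseteq> {x :: 'a. 0 \<le> x}"
    by (auto simp: eucl_le [where 'a = 'a] inner_Basis)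
  show "convex_cone {x :: 'a. 0 \<le> x}"
    by (auto simp: convex_cone_iff intro: add_nonneg_nonneg scaleR_nonneg_nonneg)
next
  fix K :: "'a set"
  assume K: "Basis \<subseteq> K" "convex_cone K"
  show "{x. 0 \<le> x} \<subseteq> K"
  proof clarify
    fix x :: 'a
    assume x: "0 \<le> x"
    have "(\<Sum>i\<in>J. (x \<bullet> i) *\<^sub>R i) \<in> K" if "finite J" "J \<subseteq> Basis" for J
      using that
    proof induction
      case empty
      show ?case using convex_cone_contains_0 [OF K(2)] by simp
    next
      case (insert i J)
      then have "(x \<bullet> i) *\<^sub>R i \<in> K"
        using x K by (intro convex_cone_scaleR) (auto simp: eucl_le [where 'a = 'a])
      with insert show ?case
        using convex_cone_add [OF K(2)] by simp
    qed
    from this [of Basis] show "x \<in> K"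
      by (simp add: euclidean_representation)
  qed
qed

text \<open>
  A linear image of a closed set need not be closed. Here it is, because the image is generated as a
  cone by the finitely many images of the basis vectors.
\<close>

lemma closed_linear_image_nonneg_orthant:
  fixes f :: "'a :: ordered_euclidean_space \<Rightarrow> 'b :: euclidean_space"
  assumes "linear f"
  shows "closed (f ` {x. 0 \<le> x})"
proof -
  have "f ` {x. 0 \<le> x} = convex_cone hull (f ` Basis)"
    by (simp add: nonneg_orthant_eq_convex_cone_hull convex_cone_hull_linear_image [OF assms])
  then show ?thesis
    by (simp add: closed_convex_cone_hull)
qed

text \<open>
  The feasible set may be unbounded, so compactness is not available; closedness of the set of
  attainable objective values replaces it.
\<close>

lemma linear_program_attains_max:
  fixes h :: "'a :: ordered_euclidean_space \<Rightarrow> 'b :: ordered_euclidean_space"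
    and g :: 'a and c :: 'b
  defines "F \<equiv> {x. 0 \<le> x \<and> h x \<le> c}"
  assumes "linear h" "F \<noteq> {}" "bdd_above ((\<lambda>x. g \<bullet> x) ` F)"
  obtains x where "x \<in> F" "\<And>z. z \<in> F \<Longrightarrow> g \<bullet> z \<le> g \<bullet> x"
proof -
  \<comment> \<open>The second argument is the slack, which turns \<open>h x \<le> c\<close> into the equation \<open>h x + s = c\<close>.\<close>
  define f where "f = (\<lambda>(x, s). (h x + s, g \<bullet> x))"
  define T where "T = (\<lambda>x. g \<bullet> x) ` F"
  have "linear f"
    using \<open>linear h\<close>
    by (auto simp: f_def linear_iff algebra_simps)
  then have "closed (f ` {p. 0 \<le> p})"
    by (rule closed_linear_image_nonneg_orthant)
  moreover have "T = Pair c -` (f ` {p. 0 \<le> p})"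
  proof (intro equalityI subsetI)
    fix t assume "t \<in> T"
    then obtain x where x: "0 \<le> x" "h x \<le> c" "t = g \<bullet> x"
      by (auto simp: T_def F_def)
    then have "(c, t) = f (x, c - h x)" "0 \<le> (x, c - h x)"
      by (auto simp: f_def less_eq_prod_def)
    then show "t \<in> Pair c -` (f ` {p. 0 \<le> p})"
      by blast
  next
    fix t assume "t \<in> Pair c -` (f ` {p. 0 \<le> p})"
    then show "t \<in> T"
      by (force simp: T_def F_def f_def less_eq_prod_def)
  qed
  \<comment> \<open>The slice of a closed set at a fixed first component is closed.\<close>
  ultimately have "closed T"
    by (simp add: continuous_closed_vimage)
  moreover have T: "T \<noteq> {}" "bdd_above T"
    using assms by (auto simp: T_def)
  ultimately have "Sup T \<in> T"
    by (intro closed_contains_Sup)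
  then obtain x where "x \<in> F" "Sup T = g \<bullet> x"
    by (auto simp: T_def)
  then show thesis
    using that T(2) by (metis T_def cSup_upper imageI)
qed

lemma inner_mono_nonneg:
  fixes u v w :: "'a :: ordered_euclidean_space"
  assumes "u \<le> v" "0 \<le> w"
  shows "u \<bullet> w \<le> v \<bullet> w"
  using assms unfolding euclidean_inner [of _ w] eucl_le [where 'a = 'a]
  by (auto intro!: sum_mono mult_right_mono)

text \<open>
  Pairing the primal constraints with the nonnegative multipliers and the dual constraints with the
  nonnegative \<open>x\<close> sandwiches the same bilinear expression between the two objective values.
\<close>

lemma linear_program_weak_duality:
  assumes "x \<in> recourse_feasible B G g d" and "dual_feasible B G q lam \<mu>"
  shows "d \<bullet> lam + g \<bullet> \<mu> \<le> q \<bullet> x"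
proof -
  have "d \<bullet> lam + g \<bullet> \<mu> \<le> (B *v x) \<bullet> lam + (G *v x) \<bullet> \<mu>"
    using assms by (intro add_mono inner_mono_nonneg)
      (auto simp: recourse_feasible_def dual_feasible_def)
  also have "\<dots> = (transpose B *v lam + transpose G *v \<mu>) \<bullet> x"
    by (simp add: inner_add_left dot_lmul_matrix inner_commute [of lam] inner_commute [of \<mu>])
  also have "\<dots> \<le> q \<bullet> x"
    using assms by (intro inner_mono_nonneg)
      (auto simp: recourse_feasible_def dual_feasible_def)
  finally show ?thesis .
qed

lemma dual_feasible_iff_completion_feasible:
  "dual_feasible B G q lam \<mu> \<longleftrightarrow> 0 \<le> lam \<and> \<mu> \<in> completion_feasible B G q lam"
  by (auto simp: dual_feasible_def completion_feasible_def le_diff_eq add.commute)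

text \<open>
  The multipliers are feasible for the dual whatever \<open>y\<close> is, since \<open>y\<close> enters
  only the dual objective; a single pair thus yields a cut at every \<open>y\<close>. Where the recourse program
  is infeasible, the infimum is over the empty set and equals \<open>\<infinity>\<close>.
\<close>

lemma dual_feasible_imp_valid_cut:
  assumes "dual_feasible B G q lam \<mu>"
  shows "valid_cut_at (recourse_value A B G b g q) (\<lambda>y. rhs A b y \<bullet> lam + g \<bullet> \<mu>) y"
  unfolding valid_cut_at_def recourse_value_def
  using linear_program_weak_duality [OF _ assms] by (auto intro!: INF_greatest)

lemma completion_optimal_exists:
  fixes B :: "real ^ 'x ^ 'l" and G :: "real ^ 'x ^ 'm"
  assumes "completion_feasible B G q lam \<noteq> {}"
    and "bdd_above ((\<lambda>\<mu>. g \<bullet> \<mu>) ` completion_feasible B G q lam)"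
  obtains \<mu> where "completion_optimal B G g q lam \<mu>"
proof -
  have "completion_feasible B G q lam = {\<mu>. 0 \<le> \<mu> \<and> transpose G *v \<mu> \<le> q - transpose B *v lam}"
    by (rule completion_feasible_def)
  with assms obtain \<mu> where "\<mu> \<in> completion_feasible B G q lam"
      "\<And>\<nu>. \<nu> \<in> completion_feasible B G q lam \<Longrightarrow> g \<bullet> \<nu> \<le> g \<bullet> \<mu>"
    using linear_program_attains_max [OF matrix_vector_mul_linear [of "transpose G"],
        of "q - transpose B *v lam" g] by metis
  then show thesis
    using that unfolding completion_optimal_def by blast
qed

lemma pos_part_nonneg: "0 \<le> pos_part v"
  by (simp add: pos_part_def less_eq_vec_def)

theorem theorem1:
  fixes A :: "real ^ 'y ^ 'l" and B :: "real ^ 'x ^ 'l" and G :: "real ^ 'x ^ 'm"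
    and b :: "real ^ 'l" and g :: "real ^ 'm" and q :: "real ^ 'x"
    and Y :: "(real ^ 'y) set"
  assumes Y_integer: "\<And>y i. y \<in> Y \<Longrightarrow> y $ i \<in> \<int>"
    and recourse: "\<And>y. y \<in> Y \<Longrightarrow>
          recourse_feasible B G g (rhs A b y) \<noteq> {} \<and>
          bdd_below ((\<lambda>x. q \<bullet> x) ` recourse_feasible B G g (rhs A b y))"
    and completion: "\<And>lam :: real ^ 'l. 0 \<le> lam \<Longrightarrow>
          completion_feasible B G q lam \<noteq> {} \<and>
          bdd_above ((\<lambda>\<mu>. g \<bullet> \<mu>) ` completion_feasible B G q lam)"
  shows "\<forall>lam_tilde :: real ^ 'l. let lam_hat = pos_part lam_tilde in
           \<exists>\<mu>. completion_optimal B G g q lam_hat \<mu> \<and>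
               dual_feasible B G q lam_hat \<mu> \<and>
               (\<forall>y. valid_cut_at (recourse_value A B G b g q)
                      (\<lambda>y. rhs A b y \<bullet> lam_hat + g \<bullet> \<mu>) y)"
proof (unfold Let_def, rule allI)
  fix lam_tilde :: "real ^ 'l"
  let ?lam = "pos_part lam_tilde"
  have lam: "0 \<le> ?lam"
    by (rule pos_part_nonneg)
  obtain \<mu> where opt: "completion_optimal B G g q ?lam \<mu>"
    using completion_optimal_exists completion [OF lam] by metis
  then have "dual_feasible B G q ?lam \<mu>"
    by (simp add: lam completion_optimal_def dual_feasible_iff_completion_feasible)
  with opt show "\<exists>\<mu>. completion_optimal B G g q ?lam \<mu> \<and> dual_feasible B G q ?lam \<mu> \<and>
      (\<forall>y. valid_cut_at (recourse_value A B G b g q) (\<lambda>y. rhs A b y \<bullet> ?lam + g \<bullet> \<mu>) y)"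
    by (intro exI [of _ \<mu>] conjI allI dual_feasible_imp_valid_cut)
qed

end
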